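(* For all integers $n,k\ge 0$, \[ D_{2n}^{(-2k-1)}=D_{2k}^{(-2n-1)}. \]
   Context: For $k\in\mathbb{Z}$ let $\mathrm{A}_k(z)=2\sum_{n=0}^\infty \frac{z^{2n+1}}{(2n+1)^k}$ (for $k\le 0$ this is a rational function; regard it as a formal power series). The poly-cosecant numbers $D_n^{(k)}$ are defined by the formal power series identity $\frac{\mathrm{A}_k(\tanh(t/2))}{\sinh t}=\sum_{n\ge0} D_n^{(k)}\frac{t^n}{n!}$. *)

theory Defs
  imports "HOL-Computational_Algebra.Formal_Power_Series"
begin

definition fps_sinh :: "rat \<Rightarrow> rat fps" where
  "fps_sinh c = fps_const (1 / 2) * (fps_exp c - fps_exp (- c))"

definition fps_cosh :: "rat \<Rightarrow> rat fps" where
  "fps_cosh c = fps_const (1 / 2) * (fps_exp c + fps_exp (- c))"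

text \<open>The parameter \<open>c\<close> follows the convention of \<^const>\<open>fps_exp\<close>:
  the series is the expansion of the function at \<open>c t\<close>.\<close>

definition fps_tanh :: "rat \<Rightarrow> rat fps" where
  "fps_tanh c = fps_sinh c / fps_cosh c"

definition polycosecant_A :: "int \<Rightarrow> rat fps" where
  "polycosecant_A k = Abs_fps (\<lambda>m. if odd m then 2 / of_nat m powi k else 0)"

text \<open>The divisor \<open>fps_sinh 1\<close> has zero constant term, but so has the dividend, so the
  division is exact and the quotient is the unique series \<open>F\<close> with
  \<open>F * fps_sinh 1 = polycosecant_A k oo fps_tanh (1 / 2)\<close>.\<close>

definition polycosecant_fps :: "int \<Rightarrow> rat fps" where
  "polycosecant_fps k = (polycosecant_A k oo fps_tanh (1 / 2)) / fps_sinh 1"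

definition polycosecant :: "int \<Rightarrow> nat \<Rightarrow> rat" where
  "polycosecant k n = fact n * fps_nth (polycosecant_fps k) n"

end

theory Submission
  imports Defs
begin

text \<open>Write \<open>s = sinh t\<close>, \<open>L f = (s f)'\<close> and \<open>h\<^sub>j = cosh t sinh\<^sup>2\<^sup>j t\<close>. The generating function of
  \<open>D\<^sup>(\<^sup>-\<^sup>m\<^sup>)\<close> is \<open>L\<^sup>m 1\<close>, so \<open>D\<close> with indices \<open>2n\<close> and \<open>- 2k - 1\<close> is the \<open>2n\<close>-th derivative
  of \<open>L\<^sup>2\<^sup>k h\<^sub>0\<close> at \<open>0\<close>. On the span of the \<open>h\<^sub>j\<close> the operator \<open>L\<^sup>2\<close> is, for the weights \<open>2j + 1\<close>,
  the transpose of the second derivative. With \<open>a\<^sub>k\<^sub>j\<close> the \<open>2k\<close>-th derivative of \<open>h\<^sub>j\<close> at \<open>0\<close>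
  this gives \<open>L\<^sup>2\<^sup>k h\<^sub>0 = \<Sum>\<^sub>j (2j + 1) a\<^sub>k\<^sub>j h\<^sub>j\<close>, and the number is
  \<open>\<Sum>\<^sub>j (2j + 1) a\<^sub>k\<^sub>j a\<^sub>n\<^sub>j\<close>, which is symmetric in \<open>k\<close> and \<open>n\<close>.\<close>

section \<open>Hyperbolic functions as formal power series\<close>

lemma fps_const_half_mult_2: "fps_const (1 / 2 :: rat) * 2 = 1"
  by (simp add: fps_numeral_fps_const)

lemma fps_exp_mult_uminus: "fps_exp (c :: rat) * fps_exp (- c) = 1"
  by (simp flip: fps_exp_add_mult)

lemma fps_deriv_sinh: "fps_deriv (fps_sinh c) = fps_const c * fps_cosh c"
  by (simp add: fps_sinh_def fps_cosh_def algebra_simps flip: fps_const_neg)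

lemma fps_deriv_cosh: "fps_deriv (fps_cosh c) = fps_const c * fps_sinh c"
  by (simp add: fps_sinh_def fps_cosh_def algebra_simps flip: fps_const_neg)

lemma fps_sinh_nth_0: "fps_nth (fps_sinh c) 0 = 0"
  by (simp add: fps_sinh_def)

lemma fps_cosh_nth_0: "fps_nth (fps_cosh c) 0 = 1"
  by (simp add: fps_cosh_def)

lemma fps_cosh_sinh_square: "fps_cosh c ^ 2 = 1 + fps_sinh c ^ 2"
proof -
  \<comment> \<open>A polynomial identity in the constant and the two exponentials; that both
    bracketed products equal 1 enters only afterwards.\<close>
  have "fps_cosh c ^ 2 - fps_sinh c ^ 2
      = (fps_const (1 / 2) * 2) ^ 2 * (fps_exp c * fps_exp (- c))"
    unfolding fps_cosh_def fps_sinh_def by algebra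
  then show ?thesis
    by (simp only: fps_const_half_mult_2 fps_exp_mult_uminus) (simp add: diff_eq_eq)
qed

lemma fps_sinh_double: "fps_sinh (2 * c) = 2 * fps_sinh c * fps_cosh c"
proof -
  have "2 * fps_sinh c * fps_cosh c
      = (fps_const (1 / 2) * 2) * (fps_const (1 / 2) * (fps_exp c ^ 2 - fps_exp (- c) ^ 2))"
    unfolding fps_cosh_def fps_sinh_def by algebra
  then show ?thesis
    by (simp add: fps_const_half_mult_2 fps_sinh_def fps_exp_power_mult)
qed

lemma fps_tanh_mult_cosh: "fps_tanh c * fps_cosh c = fps_sinh c"
proof -
  have "fps_cosh c dvd 1"
    by (simp add: fps_is_unit_iff fps_cosh_nth_0)
  then have "fps_cosh c dvd fps_sinh c"
    using dvd_trans one_dvd by blast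
  then show ?thesis
    unfolding fps_tanh_def by (rule dvd_div_mult_self)
qed

lemma fps_cosh_nonzero: "fps_cosh c \<noteq> 0"
  using fps_cosh_nth_0[of c] by auto

lemma fps_sinh_1_nonzero: "fps_sinh 1 \<noteq> 0"
proof
  assume "fps_sinh 1 = 0"
  then have "fps_cosh 1 = 0"
    using fps_deriv_sinh[of 1] by simp
  then show False
    by (simp add: fps_cosh_nonzero)
qed

lemma fps_tanh_nth_0: "fps_nth (fps_tanh c) 0 = 0"
  using arg_cong[OF fps_tanh_mult_cosh, of "\<lambda>f. fps_nth f 0" c]
  by (simp add: fps_sinh_nth_0 fps_cosh_nth_0)

lemma fps_deriv_tanh_mult_cosh_square:
  "fps_deriv (fps_tanh c) * fps_cosh c ^ 2 = fps_const c"
proof -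
  have "fps_deriv (fps_tanh c * fps_cosh c) = fps_deriv (fps_sinh c)"
    by (simp add: fps_tanh_mult_cosh)
  then have "fps_deriv (fps_tanh c) * fps_cosh c
      = fps_const c * (fps_cosh c - fps_tanh c * fps_sinh c)"
    by (simp add: fps_deriv_sinh fps_deriv_cosh algebra_simps)
  then have "fps_deriv (fps_tanh c) * fps_cosh c ^ 2
      = fps_const c * (fps_cosh c ^ 2 - (fps_tanh c * fps_cosh c) * fps_sinh c)"
    by (simp only: power2_eq_square mult.assoc[symmetric]) (simp add: algebra_simps)
  also have "\<dots> = fps_const c"
    by (simp only: fps_tanh_mult_cosh fps_cosh_sinh_square) (simp add: power2_eq_square)
  finally show ?thesis .
qed

text \<open>The chain-rule factor needed to carry \<open>z d/dz\<close> over to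
  \<open>sinh t d/dt\<close>. Multiplying by \<open>cosh\<^sup>2 (t / 2)\<close> clears the
  denominators.\<close>

lemma fps_deriv_tanh_mult_sinh: "fps_deriv (fps_tanh (1 / 2)) * fps_sinh 1 = fps_tanh (1 / 2)"
proof -
  let ?c = "fps_cosh (1 / 2)" and ?T = "fps_tanh (1 / 2)"
  have "fps_sinh 1 = 2 * fps_sinh (1 / 2) * ?c"
    using fps_sinh_double[of "1 / 2"] by simp
  then have "(fps_deriv ?T * fps_sinh 1) * ?c ^ 2 = ?T * ?c ^ 2"
    using fps_deriv_tanh_mult_cosh_square[of "1 / 2"] fps_tanh_mult_cosh[of "1 / 2"]
      fps_const_half_mult_2
    by algebra
  then show ?thesis
    by (simp add: fps_cosh_nonzero)
qed

section \<open>Generating functions for nonpositive index\<close>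

lemma polycosecant_A_0: "(1 - fps_X ^ 2) * polycosecant_A 0 = 2 * fps_X"
proof (rule fps_ext)
  fix n
  show "fps_nth ((1 - fps_X ^ 2) * polycosecant_A 0) n = fps_nth (2 * fps_X) n"
    by (auto simp: polycosecant_A_def algebra_simps fps_X_power_mult_nth fps_numeral_fps_const
        less_2_cases_iff)
qed

lemma fps_nth_polycosecant_A_uminus:
  "fps_nth (polycosecant_A (- int m)) n = (if odd n then 2 * of_nat n ^ m else 0)"
  by (simp add: polycosecant_A_def power_int_minus divide_inverse)

lemma polycosecant_A_uminus_Suc:
  "polycosecant_A (- int (Suc m)) = fps_X * fps_deriv (polycosecant_A (- int m))"
proof (rule fps_ext)
  fix n
  show "fps_nth (polycosecant_A (- int (Suc m))) n
      = fps_nth (fps_X * fps_deriv (polycosecant_A (- int m))) n"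
    by (cases n) (simp_all add: fps_nth_polycosecant_A_uminus del: of_nat_Suc)
qed

text \<open>This is \<open>L\<close>, the conjugate of \<open>sinh t d/dt\<close> by multiplication
  with \<open>sinh t\<close>; conjugating absorbs the divisor \<open>sinh t\<close> of the
  generating function.\<close>

definition deriv_sinh_mult :: "rat fps \<Rightarrow> rat fps" where
  "deriv_sinh_mult f = fps_deriv (fps_sinh 1 * f)"

text \<open>Under \<open>z = tanh (t / 2)\<close> the Euler operator \<open>z d/dz\<close>, which lowers the index \<open>k\<close> of
  \<open>A\<^sub>k\<close> by one, becomes \<open>sinh t d/dt\<close>.\<close>

lemma polycosecant_A_compose_tanh:
  "polycosecant_A (- int m) oo fps_tanh (1 / 2) = fps_sinh 1 * (deriv_sinh_mult ^^ m) 1"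
proof (induction m)
  case 0
  let ?T = "fps_tanh (1 / 2)" and ?c = "fps_cosh (1 / 2)"
    and ?G = "polycosecant_A 0 oo fps_tanh (1 / 2)"
  have "((1 - fps_X ^ 2) * polycosecant_A 0) oo ?T = (2 * fps_X) oo ?T"
    by (simp only: polycosecant_A_0)
  then have "(1 - ?T ^ 2) * ?G = 2 * ?T"
    by (simp add: fps_compose_mult_distrib fps_compose_sub_distrib fps_tanh_nth_0
        fps_numeral_fps_const flip: fps_compose_power)
  moreover have "fps_sinh 1 = 2 * fps_sinh (1 / 2) * ?c"
    using fps_sinh_double[of "1 / 2"] by simp
  \<comment> \<open>Since \<open>1 - T\<^sup>2 = 1 / cosh\<^sup>2 (t / 2)\<close>, the quotient
    \<open>2 T / (1 - T\<^sup>2)\<close> is \<open>2 sinh (t / 2) cosh (t / 2)\<close>.\<close>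
  ultimately have "?G = fps_sinh 1"
    using fps_cosh_sinh_square[of "1 / 2"] fps_tanh_mult_cosh[of "1 / 2"]
    by algebra
  then show ?case
    by simp
next
  case (Suc m)
  let ?T = "fps_tanh (1 / 2)" and ?A = "polycosecant_A (- int m)"
  have "polycosecant_A (- int (Suc m)) oo ?T = ?T * (fps_deriv ?A oo ?T)"
    by (simp only: polycosecant_A_uminus_Suc fps_compose_mult_distrib fps_tanh_nth_0
        fps_X_fps_compose_startby0)
  also have "\<dots> = (fps_deriv ?T * fps_sinh 1) * (fps_deriv ?A oo ?T)"
    by (simp only: fps_deriv_tanh_mult_sinh)
  also have "\<dots> = fps_sinh 1 * fps_deriv (?A oo ?T)"
    by (simp add: fps_compose_deriv fps_tanh_nth_0 ac_simps)
  also have "\<dots> = fps_sinh 1 * (deriv_sinh_mult ^^ Suc m) 1"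
    by (simp only: Suc.IH funpow.simps o_apply deriv_sinh_mult_def[of "(deriv_sinh_mult ^^ m) 1"])
  finally show ?case .
qed

lemma polycosecant_fps_uminus: "polycosecant_fps (- int m) = (deriv_sinh_mult ^^ m) 1"
  by (simp add: polycosecant_fps_def polycosecant_A_compose_tanh fps_sinh_1_nonzero)

section \<open>The action of \<open>L\<^sup>2\<close> and of the second derivative on the
  \<open>h\<^sub>j\<close>\<close>

definition cosh_sinh :: "nat \<Rightarrow> rat fps" where
  "cosh_sinh j = fps_cosh 1 * fps_sinh 1 ^ (2 * j)"

lemma fps_deriv_sinh_power:
  "fps_deriv (fps_sinh 1 ^ Suc p) = of_nat (Suc p) * fps_cosh 1 * fps_sinh 1 ^ p"
  by (simp add: fps_deriv_power fps_deriv_sinh fps_of_nat algebra_simps del: power_Suc of_nat_Suc)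

text \<open>Replacing \<open>cosh\<^sup>2\<close> by \<open>1 + sinh\<^sup>2\<close> leaves pure
  powers of \<open>sinh\<close>; one more derivative then leads back to the
  \<open>h\<^sub>j\<close>.\<close>

lemma fps_deriv_cosh_sinh_power:
  "fps_deriv (fps_cosh 1 * fps_sinh 1 ^ Suc p)
    = of_nat (p + 2) * fps_sinh 1 ^ (p + 2) + of_nat (p + 1) * fps_sinh 1 ^ p"
proof -
  have "fps_deriv (fps_cosh 1 * fps_sinh 1 ^ Suc p)
      = fps_cosh 1 * fps_deriv (fps_sinh 1 ^ Suc p) + fps_deriv (fps_cosh 1) * fps_sinh 1 ^ Suc p"
    by (simp only: fps_deriv_mult)
  also have "\<dots> = of_nat (Suc p) * fps_cosh 1 ^ 2 * fps_sinh 1 ^ p + fps_sinh 1 ^ (p + 2)"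
    unfolding fps_deriv_sinh_power fps_deriv_cosh
    by (simp add: power2_eq_square algebra_simps)
  also have "\<dots> = of_nat (p + 2) * fps_sinh 1 ^ (p + 2) + of_nat (p + 1) * fps_sinh 1 ^ p"
    unfolding fps_cosh_sinh_square by (simp add: algebra_simps power2_eq_square)
  finally show ?thesis .
qed

lemma deriv_sinh_mult_twice_cosh_sinh:
  "deriv_sinh_mult (deriv_sinh_mult (cosh_sinh j))
    = of_nat ((2 * j + 1) ^ 2) * cosh_sinh j
      + of_nat ((2 * j + 2) * (2 * j + 3)) * cosh_sinh (Suc j)"
proof -
  have "deriv_sinh_mult (cosh_sinh j) = fps_deriv (fps_cosh 1 * fps_sinh 1 ^ Suc (2 * j))"
    by (simp add: deriv_sinh_mult_def cosh_sinh_def mult.left_commute)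
  also have "\<dots> = of_nat (2 * j + 2) * fps_sinh 1 ^ (2 * j + 2)
      + of_nat (2 * j + 1) * fps_sinh 1 ^ (2 * j)"
    by (rule fps_deriv_cosh_sinh_power)
  finally have "fps_sinh 1 * deriv_sinh_mult (cosh_sinh j)
      = of_nat (2 * j + 2) * fps_sinh 1 ^ Suc (2 * j + 2)
        + of_nat (2 * j + 1) * fps_sinh 1 ^ Suc (2 * j)"
    by (simp add: algebra_simps)
  then have "deriv_sinh_mult (deriv_sinh_mult (cosh_sinh j))
      = of_nat (2 * j + 2) * fps_deriv (fps_sinh 1 ^ Suc (2 * j + 2))
        + of_nat (2 * j + 1) * fps_deriv (fps_sinh 1 ^ Suc (2 * j))"
    by (simp add: deriv_sinh_mult_def del: power_Suc of_nat_add of_nat_Suc)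
  then show ?thesis
    unfolding fps_deriv_sinh_power cosh_sinh_def
    by (simp add: algebra_simps power2_eq_square)
qed

text \<open>At \<open>j = 0\<close> the truncated \<open>j - 1\<close> is harmless, as its factor
  \<open>2 * j\<close> vanishes.\<close>

lemma fps_deriv_twice_cosh_sinh:
  "fps_deriv (fps_deriv (cosh_sinh j))
    = of_nat ((2 * j + 1) ^ 2) * cosh_sinh j
      + of_nat (2 * j * (2 * j - 1)) * cosh_sinh (j - 1)"
proof (cases j)
  case 0
  then show ?thesis
    by (simp add: cosh_sinh_def fps_deriv_cosh fps_deriv_sinh)
next
  case (Suc i)
  have "fps_deriv (cosh_sinh j) = fps_deriv (fps_cosh 1 * fps_sinh 1 ^ Suc (2 * i + 1))"
    by (simp add: Suc cosh_sinh_def)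
  also have "\<dots> = of_nat (2 * i + 3) * fps_sinh 1 ^ Suc (2 * i + 2)
      + of_nat (2 * i + 2) * fps_sinh 1 ^ Suc (2 * i)"
    by (subst fps_deriv_cosh_sinh_power) (simp add: numeral_eq_Suc)
  finally have "fps_deriv (fps_deriv (cosh_sinh j))
      = of_nat (2 * i + 3) * fps_deriv (fps_sinh 1 ^ Suc (2 * i + 2))
        + of_nat (2 * i + 2) * fps_deriv (fps_sinh 1 ^ Suc (2 * i))"
    by (simp del: power_Suc of_nat_add of_nat_Suc)
  then show ?thesis
    unfolding fps_deriv_sinh_power cosh_sinh_def
    by (simp add: Suc algebra_simps power2_eq_square)
qed

text \<open>The \<open>a\<^sub>k\<^sub>j\<close>, given by the recursion that the second derivative
  of \<open>h\<^sub>j\<close> imposes.\<close>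

fun cosh_sinh_coeff :: "nat \<Rightarrow> nat \<Rightarrow> rat" where
  "cosh_sinh_coeff 0 j = (if j = 0 then 1 else 0)"
| "cosh_sinh_coeff (Suc k) j
    = of_nat ((2 * j + 1) ^ 2) * cosh_sinh_coeff k j
      + of_nat (2 * j * (2 * j - 1)) * cosh_sinh_coeff k (j - 1)"

text \<open>Reflects that \<open>h\<^sub>j\<close> has order \<open>2j\<close> at 0; it allows sums
  over \<open>j \<le> k\<close> to be extended.\<close>

lemma cosh_sinh_coeff_eq_0: "k < j \<Longrightarrow> cosh_sinh_coeff k j = 0"
  by (induction k arbitrary: j) auto

lemma fps_nth_cosh_sinh: "fact (2 * k) * fps_nth (cosh_sinh j) (2 * k) = cosh_sinh_coeff k j"
proof (induction k arbitrary: j)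
  case 0
  show ?case
    by (simp add: cosh_sinh_def fps_cosh_nth_0 fps_sinh_nth_0 fps_nth_power_0 power_0_left)
next
  case (Suc k)
  have "fact (2 * Suc k) * fps_nth (cosh_sinh j) (2 * Suc k)
      = fact (2 * k) * fps_nth (fps_deriv (fps_deriv (cosh_sinh j))) (2 * k)"
    by (simp add: algebra_simps)
  also have "\<dots> = of_nat ((2 * j + 1) ^ 2) * (fact (2 * k) * fps_nth (cosh_sinh j) (2 * k))
      + of_nat (2 * j * (2 * j - 1)) * (fact (2 * k) * fps_nth (cosh_sinh (j - 1)) (2 * k))"
    unfolding fps_deriv_twice_cosh_sinh
    by (simp add: algebra_simps flip: fps_of_nat del: of_nat_add of_nat_mult of_nat_Suc of_nat_power)
  finally show ?case
    by (simp only: Suc.IH cosh_sinh_coeff.simps)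
qed

section \<open>Expansion in the \<open>h\<^sub>j\<close> and the symmetric sum\<close>

lemma deriv_sinh_mult_sum:
  "deriv_sinh_mult (\<Sum>j\<in>A. fps_const (c j) * f j)
    = (\<Sum>j\<in>A. fps_const (c j) * deriv_sinh_mult (f j))"
  by (simp add: deriv_sinh_mult_def sum_distrib_left fps_deriv_sum algebra_simps)

lemma polycosecant_fps_odd:
  "polycosecant_fps (- int (2 * k + 1))
    = (\<Sum>j\<le>k. fps_const (of_nat (2 * j + 1) * cosh_sinh_coeff k j) * cosh_sinh j)"
proof (induction k)
  case 0
  show ?case
    using polycosecant_fps_uminus[of 1]
    by (simp add: deriv_sinh_mult_def cosh_sinh_def fps_deriv_sinh)
next
  case (Suc k)
  let ?b = "\<lambda>k j. of_nat (2 * j + 1) * cosh_sinh_coeff k j"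
  let ?p = "\<lambda>j. of_nat ((2 * j + 1) ^ 2) :: rat"
    and ?q = "\<lambda>j. of_nat ((2 * j + 2) * (2 * j + 3)) :: rat"
  have "polycosecant_fps (- int (2 * Suc k + 1))
      = deriv_sinh_mult (deriv_sinh_mult (polycosecant_fps (- int (2 * k + 1))))"
    unfolding polycosecant_fps_uminus by simp
  also have "\<dots> = (\<Sum>j\<le>k. fps_const (?b k j) * deriv_sinh_mult (deriv_sinh_mult (cosh_sinh j)))"
    by (simp only: Suc.IH deriv_sinh_mult_sum)
  also have "\<dots> = (\<Sum>j\<le>k. fps_const (?p j * ?b k j) * cosh_sinh j)
      + (\<Sum>j\<le>k. fps_const (?q j * ?b k j) * cosh_sinh (Suc j))"
    unfolding deriv_sinh_mult_twice_cosh_sinh sum.distrib[symmetric]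
    by (intro sum.cong refl)
      (simp only: fps_of_nat[symmetric] fps_const_mult[symmetric] ring_distribs ac_simps)
  also have "(\<Sum>j\<le>k. fps_const (?p j * ?b k j) * cosh_sinh j)
      = (\<Sum>j\<le>Suc k. fps_const (?p j * ?b k j) * cosh_sinh j)"
    by (simp add: cosh_sinh_coeff_eq_0)
  \<comment> \<open>After the shift \<open>?q (j - 1)\<close> reads \<open>2j (2j + 1)\<close>, and
    the new term at \<open>j = 0\<close> is zero.\<close>
  also have "(\<Sum>j\<le>k. fps_const (?q j * ?b k j) * cosh_sinh (Suc j))
      = (\<Sum>j\<le>Suc k. fps_const (of_nat (2 * j * (2 * j + 1)) * ?b k (j - 1)) * cosh_sinh j)"
    by (subst sum.atMost_Suc_shift) (simp add: algebra_simps)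
  also have "(\<Sum>j\<le>Suc k. fps_const (?p j * ?b k j) * cosh_sinh j) + \<dots>
      = (\<Sum>j\<le>Suc k. fps_const (?b (Suc k) j) * cosh_sinh j)"
    unfolding sum.distrib[symmetric]
  proof (intro sum.cong refl)
    fix j
    \<comment> \<open>The transposition: \<open>2j (2j + 1)\<close> times the weight
      \<open>2j - 1\<close> is the weight \<open>2j + 1\<close> times the coefficient
      \<open>2j (2j - 1)\<close> of the second derivative.\<close>
    have "?p j * ?b k j + of_nat (2 * j * (2 * j + 1)) * ?b k (j - 1) = ?b (Suc k) j"
      by (cases j) (simp_all add: algebra_simps power2_eq_square)
    then show "fps_const (?p j * ?b k j) * cosh_sinh j
        + fps_const (of_nat (2 * j * (2 * j + 1)) * ?b k (j - 1)) * cosh_sinh j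
        = fps_const (?b (Suc k) j) * cosh_sinh j"
      by (metis distrib_right fps_const_add)
  qed
  finally show ?case .
qed

text \<open>The free bound \<open>N\<close> lets both numbers be written over one common range,
  where exchanging \<open>k\<close> and \<open>n\<close> only permutes factors.\<close>

lemma polycosecant_odd_even:
  assumes "k \<le> N"
  shows "polycosecant (- 2 * int k - 1) (2 * n)
    = (\<Sum>j\<le>N. of_nat (2 * j + 1) * cosh_sinh_coeff k j * cosh_sinh_coeff n j)"
proof -
  have "- 2 * int k - 1 = - int (2 * k + 1)"
    by simp
  then have "polycosecant (- 2 * int k - 1) (2 * n)
      = (\<Sum>j\<le>k. of_nat (2 * j + 1) * cosh_sinh_coeff k j
          * (fact (2 * n) * fps_nth (cosh_sinh j) (2 * n)))"
    by (simp only: polycosecant_def polycosecant_fps_odd fps_sum_nth fps_mult_left_const_nth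
        sum_distrib_left mult.left_commute)
  also have "\<dots> = (\<Sum>j\<le>k. of_nat (2 * j + 1) * cosh_sinh_coeff k j * cosh_sinh_coeff n j)"
    by (simp only: fps_nth_cosh_sinh)
  also have "\<dots> = (\<Sum>j\<le>N. of_nat (2 * j + 1) * cosh_sinh_coeff k j * cosh_sinh_coeff n j)"
    using assms by (intro sum.mono_neutral_left) (auto simp: cosh_sinh_coeff_eq_0)
  finally show ?thesis .
qed

theorem theorem3p1:
  fixes n k :: nat
  shows "polycosecant (- 2 * int k - 1) (2 * n) = polycosecant (- 2 * int n - 1) (2 * k)"
proof -
  have "polycosecant (- 2 * int k - 1) (2 * n)
      = (\<Sum>j\<le>max k n. of_nat (2 * j + 1) * cosh_sinh_coeff k j * cosh_sinh_coeff n j)"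
    by (rule polycosecant_odd_even) (rule max.cobounded1)
  also have "\<dots> = (\<Sum>j\<le>max k n. of_nat (2 * j + 1) * cosh_sinh_coeff n j * cosh_sinh_coeff k j)"
    by (intro sum.cong refl) simp
  also have "\<dots> = polycosecant (- 2 * int n - 1) (2 * k)"
    by (rule polycosecant_odd_even[symmetric]) (rule max.cobounded2)
  finally show ?thesis .
qed

end
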